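(* Let $n$ be a positive integer and let $\mathfrak{C}_n$ be a cyclic group of order $n$ acting on $[0,n-1]=\{0,1,\ldots,n-1\}$ by rotation. Let $r$ be a nonnegative integer and let $k$ be a positive integer with $(r+1)k\le n$. Define $$i_{k,r,n}(q)=\frac{[n]}{[n-rk]}\begin{bmatrix} n-rk\\ k\end{bmatrix}.$$ Then $i_{k,r,n}(q)$ is a polynomial in $q$, and $$\left(\mathcal{I}_k(C_n^r),\ \mathfrak{C}_n,\ i_{k,r,n}(q)\right)$$ exhibits the cyclic sieving phenomenon.
   Context: For a nonnegative integer $m$, $[m]=1+q+\cdots+q^{m-1}$ (so $[0]=0$), and $\begin{bmatrix} a\\ b\end{bmatrix}$ is the $q$-binomial coefficient, equal to $\frac{[a]!}{[b]!\,[a-b]!}$ for $0\le b\le a$ (with $[m]!=[1][2]\cdots[m]$). $C_n^r$ is the $r$th power of the cycle graph: it has vertex set $[0,n-1]$ and edges $j\sim (j+\ell)\bmod n$ for all $j\in[0,n-1]$ and all $\ell\in\{1,\ldots,r\}$; $C_n^0$ is the edgeless graph. $\mathcal{I}_k(G)$ is the collection of independent sets of size $k$ of a graph $G$. All graphs are finite and simple. Action by rotation: a generator $\mathfrak{g}$ of $\mathfrak{C}_n$ acts by $\mathfrak{g}(i)=(i+1)\bmod n$. This preserves adjacency in $C_n^r$, and induces an action on $\mathcal{I}_k(C_n^r)$ by $\mathfrak{g}S=\{\mathfrak{g}v: v\in S\}$. Cyclic sieving phenomenon (CSP): for a finite cyclic group $\mathfrak{C}$, a finite set $X$ and a polynomial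 $f(q)$, the triple $(X,\mathfrak{C},f(q))$ exhibits the CSP if $\mathfrak{C}$ acts on $X$ and for every $\mathfrak{g}\in\mathfrak{C}$ of order $d$ and every primitive $d$th root of unity $\omega\in\mathbb{C}$ we have $|X^{\mathfrak{g}}|=f(\omega)$, where $X^{\mathfrak{g}}=\{x\in X:\mathfrak{g}x=x\}$. *)

theory Defs
  imports
    Complex_Main
    "HOL-Library.Ramsey"
    "HOL-Algebra.Elementary_Groups"
    "HOL-Algebra.Multiplicative_Group"
    "HOL-Algebra.Group_Action"
    "HOL-Computational_Algebra.Polynomial_Factorial"
begin

section \<open>\<open>q\<close>-analogues\<close>

definition q_int :: "nat \<Rightarrow> int poly" where
  "q_int m = (\<Sum>i<m. [:0, 1:] ^ i)"

definition q_fact :: "nat \<Rightarrow> int poly" where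
  "q_fact m = (\<Prod>i=1..m. q_int i)"

text \<open>
  The quotients below are formed in the field of fractions of \<open>\<int>[q]\<close>, so that being a
  polynomial is a property that has to be proved.
\<close>

definition q_binomial :: "nat \<Rightarrow> nat \<Rightarrow> int poly fract" where
  "q_binomial a b =
     (if b \<le> a then to_fract (q_fact a) / (to_fract (q_fact b) * to_fract (q_fact (a - b))) else 0)"

definition q_indep_count :: "nat \<Rightarrow> nat \<Rightarrow> nat \<Rightarrow> int poly fract" where
  "q_indep_count k r n =
     to_fract (q_int n) / to_fract (q_int (n - r * k)) * q_binomial (n - r * k) k"

section \<open>Powers of cycle graphs and their independent sets\<close>

text \<open>
  A graph is given by its vertex set and its set of edges, an edge being the set of its two ends.
  For \<open>r < n\<close> all members of the following set have two elements, so the graph is simple.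
\<close>

definition cycle_power_edges :: "nat \<Rightarrow> nat \<Rightarrow> nat set set" where
  "cycle_power_edges n r = {{j, (j + l) mod n} | j l. j \<in> {0..<n} \<and> l \<in> {1..r}}"

definition independent_sets :: "nat \<Rightarrow> 'a set \<Rightarrow> 'a set set \<Rightarrow> 'a set set" where
  "independent_sets k V E = {S. S \<subseteq> V \<and> finite S \<and> card S = k \<and> indep S E}"

section \<open>Cyclic sieving\<close>

text \<open>
  Actions in the sense of \<^locale>\<open>group_action\<close> consist of functions that are undefined outside
  of the set acted on, whence the restriction.
\<close>

definition image_action :: "('g \<Rightarrow> 'a \<Rightarrow> 'a) \<Rightarrow> 'a set set \<Rightarrow> 'g \<Rightarrow> 'a set \<Rightarrow> 'a set" where
  "image_action \<phi> X h = (\<lambda>S\<in>X. \<phi> h ` S)"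

definition primitive_root_of_unity :: "nat \<Rightarrow> complex \<Rightarrow> bool" where
  "primitive_root_of_unity d \<omega> \<longleftrightarrow> d > 0 \<and> \<omega> ^ d = 1 \<and> (\<forall>j. 0 < j \<and> j < d \<longrightarrow> \<omega> ^ j \<noteq> 1)"

definition cyclic_sieving ::
    "'x set \<Rightarrow> 'g monoid \<Rightarrow> ('g \<Rightarrow> 'x \<Rightarrow> 'x) \<Rightarrow> complex poly \<Rightarrow> bool" where
  "cyclic_sieving X G \<psi> f \<longleftrightarrow>
     finite X \<and> group G \<and> finite (carrier G) \<and> cyclic_group G \<and> group_action G X \<psi> \<and>
     (\<forall>h\<in>carrier G. \<forall>\<omega>. primitive_root_of_unity (group.ord G h) \<omega> \<longrightarrow>
        of_nat (card {x \<in> X. \<psi> h x = x}) = poly f \<omega>)"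

end

theory Submission
  imports Defs
begin

text \<open>
  Write \<open>m = n - r k\<close>. Both sides of the sieving identity can be computed in closed form, and the
  two computations give the same number.

  On the polynomial side, \<open>[n] = [m] + q^m [r k]\<close> and \<open>[r k] = [k] (1 + q^k + \<dots> + q^((r - 1) k))\<close>,
  while the absorption identity turns \<open>[k]\<close> times the \<open>q\<close>-binomial of \<open>m\<close> over \<open>k\<close> into \<open>[m]\<close> times
  that of \<open>m - 1\<close> over \<open>k - 1\<close>. So the factor \<open>[m]\<close> cancels and the quotient is a combination of two
  \<open>q\<close>-binomials with polynomial coefficients (\<open>indep_poly\<close>, \<open>q_indep_count_eq_indep_poly\<close>). At a
  primitive \<open>d\<close>-th root of unity \<open>w\<close>, the \<open>q\<close>-binomials of \<open>d\<close> vanish except at the two ends, and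
  by Pascal's rule raising the upper index by \<open>d\<close> then acts like the multiplication of a generating
  function by \<open>1 + x^d\<close> (\<open>eval_at_gauss_binomial_add\<close>). This reduces the values that are needed to
  ordinary binomial coefficients. For \<open>d\<close> dividing \<open>n\<close> the value of the polynomial is \<open>0\<close> unless
  \<open>d\<close> divides \<open>k\<close>, and otherwise it is \<open>C(m', k') + r C(m' - 1, k' - 1)\<close>, where \<open>k' = k / d\<close> and
  \<open>m' = n / d - r k'\<close>.

  On the combinatorial side, independence in the power of the cycle means that any two points are
  more than \<open>r\<close> apart around the cycle. Such \<open>k\<close>-sets either avoid the first \<open>r\<close> points or contain
  exactly one of them. Cutting the cycle there leaves a problem on a line, where a recursion on the
  length gives a binomial coefficient; the total is \<open>C(m, k) + r C(m - 1, k - 1)\<close>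
  (\<open>card_cyclically_spaced_sets\<close>). A set fixed by a rotation of order \<open>d\<close> is periodic with period
  \<open>n / d\<close>, hence it is the preimage of a set with the same spacing on the cycle of length \<open>n / d\<close> with
  \<open>k / d\<close> elements. The count just made, applied to \<open>n / d\<close> and \<open>k / d\<close>, is the value found above
  (\<open>card_rotation_fixed\<close>).
\<close>

section \<open>Gaussian binomial coefficients\<close>

fun gauss_binomial :: "nat \<Rightarrow> nat \<Rightarrow> int poly" where
  "gauss_binomial n 0 = 1"
| "gauss_binomial 0 (Suc k) = 0"
| "gauss_binomial (Suc n) (Suc k) =
     gauss_binomial n k + [:0, 1:] ^ Suc k * gauss_binomial n (Suc k)"

lemma gauss_binomial_eq_0: "n < k \<Longrightarrow> gauss_binomial n k = 0"
  by (induction n k rule: gauss_binomial.induct) auto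

lemma gauss_binomial_self [simp]: "gauss_binomial n n = 1"
  by (induction n) (auto simp: gauss_binomial_eq_0)

lemma q_int_Suc: "q_int (Suc m) = q_int m + [:0, 1:] ^ m"
  by (simp add: q_int_def)

lemma q_int_add: "q_int (a + b) = q_int a + [:0, 1:] ^ a * q_int b"
proof (induction b)
  case 0
  show ?case by (simp add: q_int_def)
next
  case (Suc b)
  then show ?case by (simp only: add_Suc_right q_int_Suc) (simp add: algebra_simps power_add)
qed

lemma q_int_mult: "q_int (k * r) = q_int k * (\<Sum>i<r. [:0, 1:] ^ (k * i))"
proof (induction r)
  case 0
  show ?case by (simp add: q_int_def)
next
  case (Suc r)
  have "q_int (k * Suc r) = q_int (k * r + k)" by (simp add: algebra_simps)
  also have "\<dots> = q_int (k * r) + [:0, 1:] ^ (k * r) * q_int k" by (rule q_int_add)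
  finally show ?case by (simp only: Suc.IH) (simp add: algebra_simps)
qed

lemma q_int_minus_one: "([:0, 1:] - 1) * q_int m = [:0, 1:] ^ m - 1"
  unfolding q_int_def by (simp only: power_diff_1_eq)

lemma q_int_nonzero: "m > 0 \<Longrightarrow> q_int m \<noteq> 0"
proof
  assume "m > 0" and "q_int m = 0"
  then have "([:0, 1:] :: int poly) ^ m = 1" using q_int_minus_one[of m] by simp
  then have "poly ([:0, 1:] ^ m) (0::int) = 1" by simp
  with \<open>m > 0\<close> show False by (simp add: poly_power power_0_left)
qed

lemma q_fact_Suc: "q_fact (Suc m) = q_fact m * q_int (Suc m)"
  by (simp add: q_fact_def)

lemma q_fact_nonzero: "q_fact m \<noteq> 0"
  by (simp add: q_fact_def q_int_nonzero)

text \<open>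
  The inductive step rests on \<open>[n + 1] = [j + 1] + q^(j + 1) [n - j]\<close>, which merges the two terms of
  Pascal's rule once they have the common factor \<open>[n]!\<close>.
\<close>

lemma gauss_binomial_fact:
  "k \<le> n \<Longrightarrow> gauss_binomial n k * (q_fact k * q_fact (n - k)) = q_fact n"
proof (induction n arbitrary: k)
  case 0
  then show ?case by (simp add: q_fact_def)
next
  case (Suc n)
  show ?case
  proof (cases k)
    case 0
    then show ?thesis by (simp add: q_fact_def)
  next
    case (Suc j)
    with Suc.prems have j: "j \<le> n" by simp
    have IH1: "gauss_binomial n j * (q_fact j * q_fact (n - j)) = q_fact n"
      by (rule Suc.IH) fact
    \<comment> \<open>For \<open>j = n\<close> the left-hand side vanishes together with \<open>q_int 0\<close>.\<close>
    have IH2: "gauss_binomial n (Suc j) * (q_fact (Suc j) * q_fact (n - j)) = q_fact n * q_int (n - j)"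
    proof (cases "j = n")
      case True
      then show ?thesis by (simp add: gauss_binomial_eq_0 q_int_def)
    next
      case False
      with j have "n - j = Suc (n - Suc j)" by simp
      with False j Suc.IH[of "Suc j"] show ?thesis
        by (simp add: q_fact_Suc mult.assoc[symmetric])
    qed
    have "gauss_binomial (Suc n) (Suc j) * (q_fact (Suc j) * q_fact (n - j))
        = (gauss_binomial n j * (q_fact j * q_fact (n - j))) * q_int (Suc j)
        + [:0, 1:] ^ Suc j * (gauss_binomial n (Suc j) * (q_fact (Suc j) * q_fact (n - j)))"
      by (simp only: gauss_binomial.simps q_fact_Suc algebra_simps)
    also have "\<dots> = q_fact n * (q_int (Suc j) + [:0, 1:] ^ Suc j * q_int (n - j))"
      by (simp only: IH1 IH2) (simp only: algebra_simps)
    also have "\<dots> = q_fact (Suc n)"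
      using j by (simp only: q_int_add[symmetric] q_fact_Suc) simp
    finally show ?thesis using Suc by simp
  qed
qed

lemma gauss_binomial_absorption:
  "q_int (Suc k) * gauss_binomial (Suc n) (Suc k) = q_int (Suc n) * gauss_binomial n k"
proof (cases "k \<le> n")
  case True
  define c where "c = q_fact k * q_fact (n - k)"
  have "c \<noteq> 0" by (simp add: c_def q_fact_nonzero)
  have "gauss_binomial (Suc n) (Suc k) * (q_fact (Suc k) * q_fact (Suc n - Suc k)) = q_fact (Suc n)"
    using True by (intro gauss_binomial_fact) simp
  then have "(q_int (Suc k) * gauss_binomial (Suc n) (Suc k)) * c = q_fact n * q_int (Suc n)"
    by (simp only: c_def q_fact_Suc diff_Suc_Suc ac_simps)
  also have "\<dots> = (q_int (Suc n) * gauss_binomial n k) * c"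
    unfolding c_def gauss_binomial_fact[OF True, symmetric] by (simp only: ac_simps)
  finally show ?thesis by (rule mult_right_cancel[OF \<open>c \<noteq> 0\<close>, THEN iffD1])
next
  case False
  then show ?thesis by (simp only: gauss_binomial_eq_0 not_le Suc_less_eq mult_zero_right)
qed

text \<open>
  The quotient \<open>[n] / [n - r k]\<close> times the \<open>q\<close>-binomial coefficient, after the cancellation of
  \<open>[n - r k]\<close>. For \<open>0 < k\<close> and \<open>(r + 1) k \<le> n\<close> its value at \<open>q = 1\<close> is the number
  \<open>C(n - r k, k) + r C(n - r k - 1, k - 1)\<close> of independent
  sets, split as in \<open>card_cyclically_spaced_sets\<close> below.
\<close>

definition indep_poly :: "nat \<Rightarrow> nat \<Rightarrow> nat \<Rightarrow> int poly" where
  "indep_poly k r n = gauss_binomial (n - r * k) k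
     + [:0, 1:] ^ (n - r * k) * (\<Sum>i<r. [:0, 1:] ^ (k * i)) * gauss_binomial (n - r * k - 1) (k - 1)"

lemma indep_poly_eq:
  assumes "k > 0" and "(r + 1) * k \<le> n"
  shows "q_int (n - r * k) * indep_poly k r n = q_int n * gauss_binomial (n - r * k) k"
proof -
  define m where "m = n - r * k"
  have n: "n = m + k * r" and "m > 0" using assms by (auto simp: m_def algebra_simps)
  have absorb: "q_int k * gauss_binomial m k = q_int m * gauss_binomial (m - 1) (k - 1)"
    using gauss_binomial_absorption[of "k - 1" "m - 1"] \<open>k > 0\<close> \<open>m > 0\<close> by simp
  define s :: "int poly" where "s = (\<Sum>i<r. [:0, 1:] ^ (k * i))"
  have "q_int n * gauss_binomial m k
      = q_int m * gauss_binomial m k + [:0, 1:] ^ m * s * (q_int k * gauss_binomial m k)"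
    unfolding n q_int_add q_int_mult s_def[symmetric] by (simp only: algebra_simps)
  also have "\<dots> = q_int m * (gauss_binomial m k + [:0, 1:] ^ m * s * gauss_binomial (m - 1) (k - 1))"
    unfolding absorb by (simp only: algebra_simps)
  finally show ?thesis by (simp add: indep_poly_def m_def s_def)
qed

lemma q_indep_count_eq_indep_poly:
  assumes "k > 0" and "(r + 1) * k \<le> n"
  shows "q_indep_count k r n = to_fract (indep_poly k r n)"
proof -
  define m where "m = n - r * k"
  have "k \<le> m" using assms by (auto simp: m_def algebra_simps)
  with \<open>k > 0\<close> have "q_int m \<noteq> 0" by (intro q_int_nonzero) simp
  have "q_binomial m k = to_fract (gauss_binomial m k)"
    unfolding q_binomial_def gauss_binomial_fact[OF \<open>k \<le> m\<close>, symmetric]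
    using \<open>k \<le> m\<close> by (simp add: q_fact_nonzero)
  then have "to_fract (q_int m) * q_indep_count k r n = to_fract (q_int n * gauss_binomial m k)"
    unfolding q_indep_count_def m_def[symmetric] using \<open>q_int m \<noteq> 0\<close> by (simp add: field_simps)
  also have "\<dots> = to_fract (q_int m) * to_fract (indep_poly k r n)"
    using indep_poly_eq[OF assms] by (simp add: m_def flip: to_fract_mult)
  finally show ?thesis using \<open>q_int m \<noteq> 0\<close> by simp
qed

section \<open>Values at roots of unity\<close>

definition eval_at :: "complex \<Rightarrow> int poly \<Rightarrow> complex" where
  "eval_at w p = poly (map_poly of_int p) w"

lemma eval_at_add [simp]: "eval_at w (p + q) = eval_at w p + eval_at w q"
proof -
  have "map_poly of_int (p + q) = (map_poly of_int p + map_poly of_int q :: complex poly)"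
    by (intro poly_eqI) (simp add: coeff_map_poly)
  then show ?thesis by (simp add: eval_at_def)
qed

lemma eval_at_mult [simp]: "eval_at w (p * q) = eval_at w p * eval_at w q"
proof -
  have "map_poly of_int (p * q) = (map_poly of_int p * map_poly of_int q :: complex poly)"
    by (intro poly_eqI) (simp add: coeff_map_poly coeff_mult)
  then show ?thesis by (simp add: eval_at_def)
qed

lemma eval_at_simps [simp]:
  "eval_at w 0 = 0" "eval_at w 1 = 1" "eval_at w [:0, 1:] = w"
  by (simp_all add: eval_at_def map_poly_pCons)

lemma eval_at_pCons [simp]: "eval_at w (pCons a p) = of_int a + w * eval_at w p"
  by (simp add: eval_at_def map_poly_pCons)

lemma eval_at_power [simp]: "eval_at w (p ^ i) = eval_at w p ^ i"
  by (induction i) auto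

lemma eval_at_sum [simp]: "eval_at w (sum f I) = (\<Sum>i\<in>I. eval_at w (f i))"
  by (induction I rule: infinite_finite_induct) auto

lemma eval_at_q_int: "(w - 1) * eval_at w (q_int m) = w ^ m - 1"
  by (simp add: q_int_def power_diff_1_eq)

lemma primitive_root_power_eq_1_iff:
  assumes "primitive_root_of_unity d w"
  shows "w ^ m = 1 \<longleftrightarrow> d dvd m"
proof -
  have "w ^ m = w ^ (d * (m div d) + m mod d)" by simp
  also have "\<dots> = w ^ (m mod d)"
    using assms unfolding power_add power_mult primitive_root_of_unity_def by simp
  finally have "w ^ m = w ^ (m mod d)" .
  moreover have "m mod d < d" using assms by (simp add: primitive_root_of_unity_def)
  ultimately show ?thesis
    using assms unfolding primitive_root_of_unity_def dvd_eq_mod_eq_0 by (metis gr0I power_0)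
qed

lemma eval_at_q_int_eq_0_iff:
  assumes "primitive_root_of_unity d w" and "d \<noteq> 1"
  shows "eval_at w (q_int m) = 0 \<longleftrightarrow> d dvd m"
proof -
  have "w \<noteq> 1" using primitive_root_power_eq_1_iff[OF assms(1), of 1] assms(2) by simp
  then have "eval_at w (q_int m) = 0 \<longleftrightarrow> w ^ m = 1"
    using eval_at_q_int[of w m] by auto
  then show ?thesis by (simp add: primitive_root_power_eq_1_iff[OF assms(1)])
qed

text \<open>
  By absorption, \<open>[k]\<close> times the coefficient of \<open>d\<close> over \<open>k\<close> is a multiple of \<open>[d]\<close>. For
  \<open>0 < k < d\<close> the root of unity annihilates \<open>[d]\<close> but not \<open>[k]\<close>.
\<close>

lemma eval_at_gauss_binomial_order:
  assumes "primitive_root_of_unity d w"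
  shows "eval_at w (gauss_binomial d k) = (if k = 0 \<or> k = d then 1 else 0)"
proof -
  consider "k = 0" | "k = d" | "d < k" | "0 < k" "k < d" by linarith
  then show ?thesis
  proof cases
    case 4
    then have "d \<noteq> 1" by simp
    have "q_int k * gauss_binomial d k = q_int d * gauss_binomial (d - 1) (k - 1)"
      using gauss_binomial_absorption[of "k - 1" "d - 1"] 4 by simp
    then have "eval_at w (q_int k) * eval_at w (gauss_binomial d k)
        = eval_at w (q_int d) * eval_at w (gauss_binomial (d - 1) (k - 1))"
      by (metis eval_at_mult)
    moreover have "eval_at w (q_int d) = 0" "eval_at w (q_int k) \<noteq> 0"
      using 4 by (auto simp: eval_at_q_int_eq_0_iff[OF assms \<open>d \<noteq> 1\<close>])
    ultimately show ?thesis using 4 by simp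
  qed (auto simp: gauss_binomial_eq_0)
qed

text \<open>
  The only consequence of the \<open>q\<close>-Lucas theorem that the evaluation needs. Both sides satisfy
  Pascal's rule in \<open>m\<close>, as its weight \<open>w ^ k\<close> does not change when \<open>k\<close> is shifted by \<open>d\<close>; they agree
  for \<open>m = 0\<close> by the previous lemma.
\<close>

lemma eval_at_gauss_binomial_add:
  assumes w: "primitive_root_of_unity d w"
  shows "eval_at w (gauss_binomial (m + d) k) = eval_at w (gauss_binomial m k)
           + (if d \<le> k then eval_at w (gauss_binomial m (k - d)) else 0)"
proof (induction m arbitrary: k)
  case 0
  have "d > 0" using w by (simp add: primitive_root_of_unity_def)
  consider "k = 0" | "k = d" | "0 < k" "k < d" | "d < k" by linarith
  then show ?case
    using \<open>d > 0\<close> by cases (auto simp: eval_at_gauss_binomial_order[OF w] gauss_binomial_eq_0)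
next
  case (Suc m)
  show ?case
  proof (cases k)
    case 0
    with w show ?thesis by (simp add: primitive_root_of_unity_def)
  next
    case (Suc j)
    have wd: "w ^ d = 1" using w by (simp add: primitive_root_of_unity_def)
    have step: "eval_at w (gauss_binomial (Suc m + d) (Suc j)) =
        eval_at w (gauss_binomial (m + d) j) + w ^ Suc j * eval_at w (gauss_binomial (m + d) (Suc j))"
      by (simp only: add_Suc gauss_binomial.simps eval_at_add eval_at_mult eval_at_power eval_at_simps)
    consider "Suc j < d" | "Suc j = d" | "d \<le> j" by linarith
    then show ?thesis
    proof cases
      case 1
      then show ?thesis unfolding Suc step Suc.IH by (simp add: algebra_simps)
    next
      case 2
      then show ?thesis unfolding Suc step Suc.IH using wd by (auto simp: algebra_simps)
    next
      case 3
      have "w ^ Suc j = w ^ Suc (j - d) * w ^ d"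
        using 3 by (simp only: power_add[symmetric]) simp
      with wd have "w ^ Suc j = w ^ Suc (j - d)" by simp
      with 3 show ?thesis unfolding Suc step Suc.IH
        by (simp add: Suc_diff_le distrib_left del: power_Suc)
    qed
  qed
qed

lemma eval_at_gauss_binomial_multiple:
  assumes w: "primitive_root_of_unity d w"
  shows "eval_at w (gauss_binomial (d * a) k) =
           (if d dvd k then of_nat (a choose (k div d)) else 0)"
proof (induction a arbitrary: k)
  case 0
  have "d > 0" using w by (simp add: primitive_root_of_unity_def)
  then show ?case by (cases k) (auto simp: div_greater_zero_iff dest: dvd_imp_le)
next
  case (Suc a)
  have "d > 0" using w by (simp add: primitive_root_of_unity_def)
  have "d * Suc a = d * a + d" by simp
  then have *: "eval_at w (gauss_binomial (d * Suc a) k) = eval_at w (gauss_binomial (d * a) k)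
           + (if d \<le> k then eval_at w (gauss_binomial (d * a) (k - d)) else 0)"
    by (simp only: eval_at_gauss_binomial_add[OF w])
  consider "k < d" | b where "k = b + d" by (metis add.commute le_Suc_ex not_le)
  then show ?case
  proof cases
    case 1
    then show ?thesis unfolding * Suc.IH by auto
  next
    case 2
    then show ?thesis unfolding * Suc.IH using \<open>d > 0\<close> by auto
  qed
qed

text \<open>
  Here the recursion starts from the row \<open>d - 1\<close>. These are the indices \<open>m - 1\<close> and \<open>k - 1\<close> of the
  second term of \<open>indep_poly\<close> when \<open>d\<close> divides \<open>m\<close> and \<open>k\<close>.
\<close>

lemma eval_at_gauss_binomial_pred_multiple:
  assumes w: "primitive_root_of_unity d w"
  shows "eval_at w (gauss_binomial (d * a + (d - 1)) (d * b + (d - 1))) = of_nat (a choose b)"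
proof (induction a arbitrary: b)
  case 0
  have "d > 0" using w by (simp add: primitive_root_of_unity_def)
  then show ?case by (cases b) (auto simp: gauss_binomial_eq_0)
next
  case (Suc a)
  have "d > 0" using w by (simp add: primitive_root_of_unity_def)
  have "d * Suc a + (d - 1) = d * a + (d - 1) + d" by simp
  then have *: "eval_at w (gauss_binomial (d * Suc a + (d - 1)) k) =
      eval_at w (gauss_binomial (d * a + (d - 1)) k)
           + (if d \<le> k then eval_at w (gauss_binomial (d * a + (d - 1)) (k - d)) else 0)" for k
    by (simp only: eval_at_gauss_binomial_add[OF w])
  show ?case
  proof (cases b)
    case 0
    have "eval_at w (gauss_binomial (d * a + (d - 1)) (d - 1)) = 1"
      using Suc.IH[of 0] by simp
    with 0 \<open>d > 0\<close> show ?thesis unfolding * by simp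
  next
    case (Suc c)
    have "d * b + (d - 1) - d = d * c + (d - 1)" "d \<le> d * b + (d - 1)" using Suc by auto
    then show ?thesis unfolding * using Suc.IH[of b] Suc.IH[of c] Suc by simp
  qed
qed

lemma eval_at_indep_poly_dvd:
  assumes w: "primitive_root_of_unity d w"
    and "d dvd k" and "d dvd n" and "k > 0" and "(r + 1) * k \<le> n"
  shows "eval_at w (indep_poly k r n) =
     of_nat (((n div d - r * (k div d)) choose (k div d))
             + r * ((n div d - r * (k div d) - 1) choose (k div d - 1)))"
proof -
  obtain b where k: "k = d * b" using assms by (auto elim: dvdE)
  obtain t where n: "n = d * t" using assms by (auto elim: dvdE)
  have "d > 0" using w by (simp add: primitive_root_of_unity_def)
  have "b > 0" using \<open>k > 0\<close> k by (cases b) auto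
  have "(r + 1) * b \<le> t"
    using assms(5) \<open>d > 0\<close> unfolding k n by (simp add: mult.left_commute)
  define m where "m = t - r * b"
  have "m > 0" using \<open>(r + 1) * b \<le> t\<close> \<open>b > 0\<close> by (simp add: m_def)
  have m: "n - r * k = d * m" unfolding k n m_def by (simp add: algebra_simps)
  have m1: "d * m - 1 = d * (m - 1) + (d - 1)" and k1: "k - 1 = d * (b - 1) + (d - 1)"
    using \<open>d > 0\<close> \<open>m > 0\<close> \<open>b > 0\<close> unfolding k by (cases m; cases b; simp)+
  have w1: "w ^ (d * i) = 1" for i by (simp add: primitive_root_power_eq_1_iff[OF w])
  have w2: "w ^ (k * i) = 1" for i by (simp add: k primitive_root_power_eq_1_iff[OF w])
  show ?thesis
    unfolding indep_poly_def m m1 k1 using \<open>d > 0\<close>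
    by (simp only: eval_at_gauss_binomial_multiple[OF w] eval_at_add eval_at_mult eval_at_sum
        eval_at_gauss_binomial_pred_multiple[OF w] w1 w2 eval_at_power eval_at_simps)
      (simp add: k n m_def \<open>d > 0\<close> del: One_nat_def)
qed

text \<open>
  There are two reasons for vanishing. If \<open>d\<close> divides \<open>n - r k\<close>, then \<open>w ^ k\<close> is an \<open>r\<close>-th root of
  unity other than \<open>1\<close>, so the geometric sum in \<open>indep_poly\<close> is zero, and so is the first
  \<open>q\<close>-binomial. Otherwise \<open>[n - r k]\<close> does not vanish at \<open>w\<close> whereas \<open>[n]\<close> does.
\<close>

lemma eval_at_indep_poly_not_dvd:
  assumes w: "primitive_root_of_unity d w"
    and "\<not> d dvd k" and "d dvd n" and "k > 0" and "(r + 1) * k \<le> n"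
  shows "eval_at w (indep_poly k r n) = 0"
proof (cases "d dvd n - r * k")
  case True
  have "r * k \<le> n" using assms(5) by simp
  with True \<open>d dvd n\<close> have "d dvd r * k" by (rule dvd_diffD1)
  then have "d dvd k * r" by (simp only: mult.commute)
  then have "(w ^ k) ^ r = 1"
    by (simp only: power_mult[symmetric] primitive_root_power_eq_1_iff[OF w])
  then have "(w ^ k - 1) * (\<Sum>i<r. (w ^ k) ^ i) = 0"
    by (simp only: power_diff_1_eq[symmetric] diff_self)
  moreover have "w ^ k \<noteq> 1" using assms(2) by (simp add: primitive_root_power_eq_1_iff[OF w])
  ultimately have "(\<Sum>i<r. w ^ (k * i)) = 0" by (simp add: power_mult)
  moreover obtain a where "n - r * k = d * a" using True by (auto elim: dvdE)
  ultimately show ?thesis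
    using assms(2) by (simp add: indep_poly_def eval_at_gauss_binomial_multiple[OF w])
next
  case False
  then have "d \<noteq> 1" by auto
  have "eval_at w (q_int (n - r * k)) * eval_at w (indep_poly k r n)
      = eval_at w (q_int n) * eval_at w (gauss_binomial (n - r * k) k)"
    using indep_poly_eq[OF assms(4,5)] by (metis eval_at_mult)
  moreover have "eval_at w (q_int n) = 0" "eval_at w (q_int (n - r * k)) \<noteq> 0"
    using False \<open>d dvd n\<close> by (simp_all add: eval_at_q_int_eq_0_iff[OF w \<open>d \<noteq> 1\<close>])
  ultimately show ?thesis by simp
qed

section \<open>Spaced sets on a line and on a cycle\<close>

definition spaced :: "nat \<Rightarrow> nat set \<Rightarrow> bool" where
  "spaced r S \<longleftrightarrow> (\<forall>x\<in>S. \<forall>y\<in>S. x < y \<longrightarrow> x + r < y)"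

text \<open>
  Independence in the power of a cycle, stated through residues: in this form it is visibly
  compatible with rotations and with the reduction to a shorter cycle.
\<close>

definition cyclically_spaced :: "nat \<Rightarrow> nat \<Rightarrow> nat set \<Rightarrow> bool" where
  "cyclically_spaced r n S \<longleftrightarrow> (\<forall>x\<in>S. \<forall>l\<in>{1..r}. (x + l) mod n \<notin> S)"

definition cyclically_spaced_sets :: "nat \<Rightarrow> nat \<Rightarrow> nat \<Rightarrow> nat set set" where
  "cyclically_spaced_sets r n k = {S. S \<subseteq> {0..<n} \<and> card S = k \<and> cyclically_spaced r n S}"

lemma independent_sets_cycle_power:
  assumes "r < n"
  shows "independent_sets k {0..<n} (cycle_power_edges n r) = cyclically_spaced_sets r n k"
proof -
  have "indep S (cycle_power_edges n r) \<longleftrightarrow> cyclically_spaced r n S" if S: "S \<subseteq> {0..<n}" for S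
  proof
    assume ind: "indep S (cycle_power_edges n r)"
    show "cyclically_spaced r n S"
      unfolding cyclically_spaced_def
    proof (intro ballI notI)
      fix x l assume x: "x \<in> S" and l: "l \<in> {1..r}" and xl: "(x + l) mod n \<in> S"
      have "x < n" using x S by auto
      have "(x + l) mod n \<noteq> x"
      proof (cases "x + l < n")
        case False
        then have "(x + l) mod n = x + l - n"
          using \<open>x < n\<close> l assms by (simp add: mod_if)
        then show ?thesis using l assms False by auto
      qed (use l in auto)
      moreover have "{x, (x + l) mod n} \<in> cycle_power_edges n r"
        using \<open>x < n\<close> l unfolding cycle_power_edges_def by auto
      ultimately show False using ind x xl unfolding indep_def by metis
    qed
  next
    assume sp: "cyclically_spaced r n S"
    show "indep S (cycle_power_edges n r)"
      unfolding indep_def cycle_power_edges_def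
    proof (intro ballI impI notI)
      fix v w assume "v \<in> S" "w \<in> S" "v \<noteq> w"
        and "{v, w} \<in> {{j, (j + l) mod n} |j l. j \<in> {0..<n} \<and> l \<in> {1..r}}"
      then obtain j l where "l \<in> {1..r}" and vw: "{v, w} = {j, (j + l) mod n}" by blast
      then have "j \<in> S" "(j + l) mod n \<in> S"
        using \<open>v \<in> S\<close> \<open>w \<in> S\<close> by (auto simp: doubleton_eq_iff)
      with sp \<open>l \<in> {1..r}\<close> show False unfolding cyclically_spaced_def by blast
    qed
  qed
  then show ?thesis
    unfolding independent_sets_def cyclically_spaced_sets_def
    by (auto intro: finite_subset[OF _ finite_atLeastLessThan])
qed

text \<open>
  With truncated subtraction the formula is also right for \<open>k = 0\<close>, where it is \<open>1\<close>, and when the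
  sets do not fit, where the upper index is smaller than \<open>k\<close>. Removing the last point of the line
  gives the recursion \<open>L(p + 1, j + 1) = L(p, j + 1) + L(p - r, j)\<close>, which is Pascal's rule for the
  right-hand sides.
\<close>

lemma card_spaced_sets:
  "card {S. S \<subseteq> {a..<a + n} \<and> card S = k \<and> spaced r S} = (n + r - r * k) choose k"
proof (induction n arbitrary: k rule: less_induct)
  case (less n)
  define F where "F = (\<lambda>n k. {S. S \<subseteq> {a..<a + n} \<and> card S = k \<and> spaced r S})"
  have IH: "card (F m j) = (m + r - r * j) choose j" if "m < n" for m j
    using less.IH[OF that] by (simp add: F_def)
  have fin: "finite S" if "S \<in> F m j" for S m j
    using that finite_subset[of S "{a..<a + m}"] by (simp add: F_def)
  have finF: "finite (F m j)" for m j
    by (rule finite_subset[of _ "Pow {a..<a + m}"]) (auto simp: F_def)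
  have "card (F n k) = (n + r - r * k) choose k"
  proof (cases "k = 0 \<or> n = 0")
    case True
    have "S = {}" if "S \<in> F n 0" for S
      using that fin[OF that] unfolding F_def by simp
    moreover have "{} \<in> F n 0" unfolding F_def spaced_def by simp
    ultimately have "F n 0 = {{}}" by blast
    moreover have "F 0 k = {}" if "k > 0" using that by (auto simp: F_def)
    ultimately show ?thesis using True by (cases "k = 0") (auto simp: binomial_eq_0)
  next
    case False
    then obtain p j where n: "n = Suc p" and k: "k = Suc j" by (metis not0_implies_Suc)
    \<comment> \<open>Either the last point is free, or it is taken and the \<open>r\<close> points before it are free.\<close>
    have split: "F (Suc p) (Suc j) = F p (Suc j) \<union> insert (a + p) ` F (p - r) j"
    proof (intro equalityI subsetI)
      fix S assume S: "S \<in> F (Suc p) (Suc j)"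
      show "S \<in> F p (Suc j) \<union> insert (a + p) ` F (p - r) j"
      proof (cases "a + p \<in> S")
        case True
        have "S - {a + p} \<subseteq> {a..<a + (p - r)}"
        proof
          fix x assume x: "x \<in> S - {a + p}"
          then have "a \<le> x" "x < a + p" using S by (auto simp: F_def less_Suc_eq)
          moreover from this have "x + r < a + p" using S x True by (auto simp: F_def spaced_def)
          ultimately show "x \<in> {a..<a + (p - r)}" by auto
        qed
        then have "S - {a + p} \<in> F (p - r) j"
          using S True fin[OF S] by (auto simp: F_def spaced_def)
        moreover have "S = insert (a + p) (S - {a + p})" using True by auto
        ultimately show ?thesis by blast
      next
        case False
        then have "S \<subseteq> {a..<a + p}" using S by (fastforce simp: F_def less_Suc_eq)
        then show ?thesis using S by (auto simp: F_def)
      qed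
    next
      fix S assume "S \<in> F p (Suc j) \<union> insert (a + p) ` F (p - r) j"
      then show "S \<in> F (Suc p) (Suc j)"
      proof
        assume "S \<in> F p (Suc j)"
        then show ?thesis by (fastforce simp: F_def)
      next
        assume "S \<in> insert (a + p) ` F (p - r) j"
        then obtain T where T: "T \<in> F (p - r) j" and S: "S = insert (a + p) T" by blast
        have below: "x \<ge> a \<and> x + r < a + p" if "x \<in> T" for x
          using T that by (fastforce simp: F_def)
        then have "a + p \<notin> T" by fastforce
        then have "card S = Suc j" using T fin[OF T] by (simp add: S F_def)
        moreover have "S \<subseteq> {a..<a + Suc p}" using below unfolding S by fastforce
        moreover have "spaced r S"
          using T below unfolding S F_def spaced_def by fastforce
        ultimately show ?thesis by (simp add: F_def)
      qed
    qed
    have "card (F (Suc p) (Suc j)) = card (F p (Suc j)) + card (insert (a + p) ` F (p - r) j)"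
      unfolding split by (intro card_Un_disjoint finite_imageI finF) (auto simp: F_def)
    also have "card (insert (a + p) ` F (p - r) j) = card (F (p - r) j)"
    proof (rule card_image)
      have "a + p \<notin> S" if "S \<in> F (p - r) j" for S
        using that by (auto simp: F_def)
      then show "inj_on (insert (a + p)) (F (p - r) j)"
        by (meson inj_onI insert_ident)
    qed
    finally have "card (F n k) = ((p - r * j) choose Suc j) + ((p - r + r - r * j) choose j)"
      using IH by (simp add: n k)
    \<comment> \<open>Pascal's rule, except when a truncated subtraction makes both sides degenerate.\<close>
    also have "\<dots> = (Suc p - r * j) choose Suc j"
    proof -
      consider "r \<le> p" "r * j \<le> p" | "p < r * j" | "p < r" "j = 0"
        by (cases j) (auto simp: not_le intro: leI)
      then show ?thesis
      proof cases
        case 1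
        then show ?thesis by (simp add: Suc_diff_le)
      next
        case 2
        then have "j > 0" by (cases j) simp_all
        then have "r \<le> r * j" by simp
        then have "p - r + r - r * j = 0" using 2 by linarith
        with 2 \<open>j > 0\<close> show ?thesis by (simp add: binomial_eq_0)
      next
        case 3
        then show ?thesis by simp
      qed
    qed
    finally show ?thesis by (simp add: n k)
  qed
  then show ?case by (simp add: F_def)
qed

text \<open>
  The condition around the cycle is the condition on the line together with the one for the arc that
  passes through \<open>0\<close>. This is what allows the cycle to be cut.
\<close>

lemma cyclically_spaced_iff:
  assumes S: "S \<subseteq> {0..<n}" and "r < n"
  shows "cyclically_spaced r n S \<longleftrightarrow>
    spaced r S \<and> (\<forall>x\<in>S. \<forall>y\<in>S. x < y \<longrightarrow> y + r < x + n)"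
proof
  assume cyc: "cyclically_spaced r n S"
  have "x + r < y \<and> y + r < x + n" if x: "x \<in> S" and y: "y \<in> S" and "x < y" for x y
  proof -
    have "y < n" using y S by auto
    have "x + r < y"
    proof (rule ccontr)
      assume "\<not> x + r < y"
      then have "y - x \<in> {1..r}" using \<open>x < y\<close> by auto
      moreover have "(x + (y - x)) mod n = y" using \<open>x < y\<close> \<open>y < n\<close> by simp
      ultimately show False using cyc x y unfolding cyclically_spaced_def by metis
    qed
    moreover have "y + r < x + n"
    proof (rule ccontr)
      assume "\<not> y + r < x + n"
      then have "x + n - y \<in> {1..r}" using \<open>y < n\<close> by auto
      moreover have "(y + (x + n - y)) mod n = x" using \<open>x < y\<close> \<open>y < n\<close> by simp
      ultimately show False using cyc x y unfolding cyclically_spaced_def by metis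
    qed
    ultimately show ?thesis by simp
  qed
  then show "spaced r S \<and> (\<forall>x\<in>S. \<forall>y\<in>S. x < y \<longrightarrow> y + r < x + n)"
    by (auto simp: spaced_def)
next
  assume sp: "spaced r S \<and> (\<forall>x\<in>S. \<forall>y\<in>S. x < y \<longrightarrow> y + r < x + n)"
  show "cyclically_spaced r n S"
    unfolding cyclically_spaced_def
  proof (intro ballI notI)
    fix x l assume x: "x \<in> S" and l: "l \<in> {1..r}" and z: "(x + l) mod n \<in> S"
    have "x < n" using x S by auto
    show False
    proof (cases "x + l < n")
      case True
      then have "x + l \<in> S" using z by simp
      moreover have "x < x + l" using l by simp
      ultimately have "x + r < x + l" using sp x unfolding spaced_def by blast
      then show False using l by simp
    next
      case False
      then have eq: "(x + l) mod n = x + l - n"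
        using \<open>x < n\<close> l assms by (simp add: mod_if)
      have "(x + l) mod n < x" using eq l \<open>r < n\<close> False by auto
      then have "x + r < (x + l) mod n + n" using sp x z by blast
      then show False using eq l False by auto
    qed
  qed
qed

text \<open>
  A spaced set contains at most one of the \<open>r\<close> points \<open>0, \<dots>, r - 1\<close>. If it contains none, what is left
  is a line of \<open>n - r\<close> points, and the arc through \<open>0\<close> is automatically long enough. If it contains
  \<open>i\<close>, the other \<open>k - 1\<close> points lie on the line of \<open>n - 2 r - 1\<close> points at distance more than \<open>r\<close>
  from \<open>i\<close>, and any two of them are far apart on the arc that passes through \<open>i\<close>.
\<close>

lemma card_cyclically_spaced_sets:
  assumes "k > 0" and "(r + 1) * k \<le> n"
  shows "card (cyclically_spaced_sets r n k) =
    ((n - r * k) choose k) + r * ((n - r * k - 1) choose (k - 1))"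
proof -
  let ?X = "cyclically_spaced_sets r n k"
  define I where "I = (\<lambda>a m j. {S. S \<subseteq> {a..<a + m} \<and> card S = j \<and> spaced r S})"
  have "(r + 1) * 1 \<le> (r + 1) * k" using \<open>k > 0\<close> by (intro mult_le_mono2) simp
  then have "r < n" using assms by simp
  define A where "A = {S \<in> ?X. S \<inter> {0..<r} = {}}"
  define B where "B = (\<lambda>i. {S \<in> ?X. i \<in> S})"
  have finX: "finite ?X"
    by (rule finite_subset[of _ "Pow {0..<n}"]) (auto simp: cyclically_spaced_sets_def)
  have X: "S \<in> ?X \<longleftrightarrow> S \<subseteq> {0..<n} \<and> card S = k \<and> spaced r S
      \<and> (\<forall>x\<in>S. \<forall>y\<in>S. x < y \<longrightarrow> y + r < x + n)" for S
    using cyclically_spaced_iff[OF _ \<open>r < n\<close>] by (auto simp: cyclically_spaced_sets_def)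
  have split: "?X = A \<union> (\<Union>i\<in>{0..<r}. B i)"
    by (auto simp: A_def B_def)
  have "A = I r (n - r) k"
  proof (intro equalityI subsetI)
    fix S assume S: "S \<in> A"
    have "x \<in> {r..<r + (n - r)}" if "x \<in> S" for x
    proof -
      have "x < n" "\<not> x < r" using S that by (auto simp: A_def X)
      then show ?thesis by simp
    qed
    then show "S \<in> I r (n - r) k" using S by (auto simp: A_def X I_def)
  next
    fix S assume S: "S \<in> I r (n - r) k"
    have b: "r \<le> x \<and> x < n" if "x \<in> S" for x
      using S that \<open>r < n\<close> by (fastforce simp: I_def)
    have gap: "y + r < x + n" if "x \<in> S" "y \<in> S" for x y
      using b[OF that(1)] b[OF that(2)] by linarith
    have "S \<subseteq> {0..<n}" "S \<inter> {0..<r} = {}" using b by (force dest: b)+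
    then show "S \<in> A" using S gap unfolding A_def mem_Collect_eq X I_def by blast
  qed
  then have cardA: "card A = (n - r * k) choose k"
    using card_spaced_sets[of r "n - r" k r] \<open>r < n\<close> by (simp add: I_def)
  have cardB: "card (B i) = (n - r * k - 1) choose (k - 1)" if "i \<in> {0..<r}" for i
  proof -
    have "i < r" using that by simp
    let ?a = "i + r + 1" and ?m = "n - 2 * r - 1"
    have inI: "i \<notin> T \<and> (\<forall>y\<in>T. i + r < y \<and> y + r < i + n)" if "T \<in> I ?a ?m (k - 1)" for T
      using that by (fastforce simp: I_def)
    have "B i = insert i ` I ?a ?m (k - 1)"
    proof (intro equalityI subsetI)
      fix S assume S: "S \<in> B i"
      have "finite S" using S finite_subset[of S "{0..<n}"] by (simp add: B_def X)
      have "y \<in> {?a..<?a + ?m}" if y: "y \<in> S - {i}" for y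
      proof -
        \<comment> \<open>A point \<open>y < i\<close> would be closer than \<open>r\<close> to \<open>i < r\<close>.\<close>
        have "\<not> y < i" using S y \<open>i < r\<close> by (fastforce simp: B_def X spaced_def)
        then have "i < y" using y by auto
        then have "i + r < y" "y + r < i + n" using S y by (auto simp: B_def X spaced_def)
        then show ?thesis by auto
      qed
      then have "S - {i} \<subseteq> {?a..<?a + ?m}" by (intro subsetI)
      then have "S - {i} \<in> I ?a ?m (k - 1)"
        using S \<open>finite S\<close> unfolding B_def X I_def spaced_def by simp
      moreover have "S = insert i (S - {i})" using S by (auto simp: B_def)
      ultimately show "S \<in> insert i ` I ?a ?m (k - 1)" by blast
    next
      fix S assume "S \<in> insert i ` I ?a ?m (k - 1)"
      then obtain T where T: "T \<in> I ?a ?m (k - 1)" and S: "S = insert i T" by blast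
      have "finite T" using T finite_subset[of T "{?a..<?a + ?m}"] by (simp add: I_def)
      have "card S = k"
        using inI[OF T] T \<open>finite T\<close> \<open>k > 0\<close> by (simp add: S I_def)
      moreover have "S \<subseteq> {0..<n}"
        using inI[OF T] \<open>i < r\<close> \<open>r < n\<close> unfolding S by fastforce
      moreover have "spaced r S"
        using inI[OF T] T unfolding S I_def spaced_def by fastforce
      moreover have "\<forall>x\<in>S. \<forall>y\<in>S. x < y \<longrightarrow> y + r < x + n"
      proof (intro ballI impI)
        fix x y assume "x \<in> S" "y \<in> S" "x < y"
        then have "i \<le> x" using inI[OF T] unfolding S by fastforce
        with \<open>x < y\<close> \<open>y \<in> S\<close> have "y \<in> T" unfolding S by simp
        then have "y + r < i + n" using inI[OF T] by blast
        with \<open>i \<le> x\<close> show "y + r < x + n" by simp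
      qed
      ultimately show "S \<in> B i" by (simp add: B_def X S)
    qed
    moreover have "inj_on (insert i) (I ?a ?m (k - 1))"
      using inI by (meson inj_onI insert_ident)
    ultimately have "card (B i) = card (I ?a ?m (k - 1))" by (simp add: card_image)
    also have "\<dots> = (?m + r - r * (k - 1)) choose (k - 1)"
      unfolding I_def by (rule card_spaced_sets)
    also have "\<dots> = (n - r * k - 1) choose (k - 1)"
    \<comment> \<open>For \<open>k = 1\<close> the subtraction in \<open>?m\<close> may truncate, but both sides are \<open>1\<close>.\<close>
    proof (cases "k = 1")
      case False
      then obtain j where k: "k = Suc (Suc j)"
        using \<open>k > 0\<close> by (metis One_nat_def Suc_pred not_gr0)
      have "n \<ge> 2 * r + 2" using assms(2) unfolding k by simp
      then have "?m + r - r * (k - 1) = n - r * k - 1" unfolding k by simp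
      then show ?thesis by simp
    qed simp
    finally show ?thesis .
  qed
  have disj: "B i \<inter> B j = {}" if "i \<in> {0..<r}" "j \<in> {0..<r}" "i \<noteq> j" for i j
  proof -
    have False if "S \<in> ?X" "i \<in> S" "j \<in> S" for S
    proof -
      have "i + r < j \<or> j + r < i"
        using that \<open>i \<noteq> j\<close> unfolding X spaced_def by (metis nat_neq_iff)
      with \<open>i \<in> {0..<r}\<close> \<open>j \<in> {0..<r}\<close> show False by auto
    qed
    then show ?thesis unfolding B_def by blast
  qed
  have "card ?X = card A + card (\<Union>i\<in>{0..<r}. B i)"
    by (subst split, rule card_Un_disjoint)
      (use finX in \<open>auto simp: A_def B_def intro: finite_subset[OF _ finX]\<close>)
  also have "card (\<Union>i\<in>{0..<r}. B i) = (\<Sum>i\<in>{0..<r}. card (B i))"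
    using disj finX by (intro card_UN_disjoint) (auto simp: B_def)
  also have "\<dots> = r * ((n - r * k - 1) choose (k - 1))" using cardB by simp
  finally show ?thesis using cardA by simp
qed

section \<open>Rotations of spaced sets\<close>

lemma cyclically_spaced_sets_rotate:
  assumes "S \<in> cyclically_spaced_sets r n k"
  shows "(\<lambda>x. (x + j) mod n) ` S \<in> cyclically_spaced_sets r n k"
proof (cases "n = 0")
  case True
  with assms show ?thesis by (auto simp: cyclically_spaced_sets_def)
next
  case False
  let ?f = "\<lambda>x. (x + j) mod n"
  have S: "S \<subseteq> {0..<n}" and sp: "cyclically_spaced r n S" and "card S = k"
    using assms by (auto simp: cyclically_spaced_sets_def)
  \<comment> \<open>Adding \<open>(n - 1) * j\<close> undoes adding \<open>j\<close> modulo \<open>n\<close>.\<close>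
  have inj: "x = y" if eq: "?f x = ?f y" and "x < n" "y < n" for x y
  proof -
    have "((x + j) mod n + (n - 1) * j) mod n = ((y + j) mod n + (n - 1) * j) mod n"
      using eq by simp
    moreover have "((z + j) mod n + (n - 1) * j) mod n = z mod n" for z
    proof -
      have "j + (n - 1) * j = n * j" using False by (cases n) auto
      then have "((z + j) mod n + (n - 1) * j) mod n = (z + n * j) mod n"
        by (metis add.assoc mod_add_left_eq)
      then show ?thesis by simp
    qed
    ultimately have "x mod n = y mod n" by (simp only:)
    then show ?thesis using that by simp
  qed
  have "inj_on ?f S" 
  proof (rule inj_onI)
    fix x y assume "x \<in> S" "y \<in> S" "?f x = ?f y"
    moreover from this S have "x < n" "y < n" by auto
    ultimately show "x = y" by (intro inj[of x y])
  qed
  then have "card (?f ` S) = k" using \<open>card S = k\<close> by (simp add: card_image)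
  moreover have "?f ` S \<subseteq> {0..<n}" using False by auto
  moreover have "cyclically_spaced r n (?f ` S)"
    unfolding cyclically_spaced_def
  proof (intro ballI notI)
    fix x l assume "x \<in> ?f ` S" and l: "l \<in> {1..r}" and "(x + l) mod n \<in> ?f ` S"
    then obtain y z where y: "y \<in> S" "x = ?f y" and z: "z \<in> S" "(x + l) mod n = ?f z" by blast
    have "?f ((y + l) mod n) = ?f z"
      unfolding z(2)[symmetric] y(2) by (simp add: mod_simps ac_simps)
    moreover have "(y + l) mod n < n" "z < n" using z(1) S False by auto
    ultimately have "(y + l) mod n = z" by (intro inj[of "(y + l) mod n" z])
    with sp y(1) z(1) l show False unfolding cyclically_spaced_def by blast
  qed
  ultimately show ?thesis by (simp add: cyclically_spaced_sets_def)
qed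

definition periodic_lift :: "nat \<Rightarrow> nat \<Rightarrow> nat set \<Rightarrow> nat set" where
  "periodic_lift n t T = {x. x < n \<and> x mod t \<in> T}"

lemma card_periodic_lift:
  assumes "t > 0" and T: "T \<subseteq> {0..<t}"
  shows "card (periodic_lift (d * t) t T) = d * card T"
proof -
  have "bij_betw (\<lambda>x. (x div t, x mod t)) (periodic_lift (d * t) t T) ({0..<d} \<times> T)"
  proof (rule bij_betw_byWitness[where f' = "\<lambda>(a, b). a * t + b"])
    show "(\<lambda>x. (x div t, x mod t)) ` periodic_lift (d * t) t T \<subseteq> {0..<d} \<times> T"
      by (auto simp: periodic_lift_def less_mult_imp_div_less)
    have "a * t + b < d * t" if "a < d" "b \<in> T" for a b
    proof -
      have "a * t + b < Suc a * t" using that T by auto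
      also have "\<dots> \<le> d * t" using that by (intro mult_le_mono1) simp
      finally show ?thesis .
    qed
    then show "(\<lambda>(a, b). a * t + b) ` ({0..<d} \<times> T) \<subseteq> periodic_lift (d * t) t T"
      using T by (auto simp: periodic_lift_def)
  qed (use T in auto)
  then show ?thesis by (simp add: bij_betw_same_card card_cartesian_product)
qed

lemma cyclically_spaced_periodic_lift:
  assumes "n > 0" and "t dvd n" and T: "T \<subseteq> {0..<t}"
  shows "cyclically_spaced r n (periodic_lift n t T) \<longleftrightarrow> cyclically_spaced r t T"
proof -
  have "t \<le> n" using assms by (simp add: dvd_imp_le)
  have *: "(x + l) mod n \<in> periodic_lift n t T \<longleftrightarrow> (x mod t + l) mod t \<in> T" for x l
    using \<open>n > 0\<close> \<open>t dvd n\<close> by (simp add: periodic_lift_def mod_mod_cancel mod_simps)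
  show ?thesis
  proof
    assume L: "cyclically_spaced r n (periodic_lift n t T)"
    show "cyclically_spaced r t T"
      unfolding cyclically_spaced_def
    proof (intro ballI)
      fix x l assume x: "x \<in> T" and l: "l \<in> {1..r}"
      have "x < t" using x T by auto
      then have "x \<in> periodic_lift n t T" using x \<open>t \<le> n\<close> by (simp add: periodic_lift_def)
      then have "(x + l) mod n \<notin> periodic_lift n t T" using L l by (simp add: cyclically_spaced_def)
      then show "(x + l) mod t \<notin> T" using * \<open>x < t\<close> by simp
    qed
  next
    assume R: "cyclically_spaced r t T"
    show "cyclically_spaced r n (periodic_lift n t T)"
      unfolding cyclically_spaced_def *
      using R by (auto simp: cyclically_spaced_def periodic_lift_def)
  qed
qed

text \<open>
  The multiples of \<open>j\<close> modulo \<open>n\<close> are the multiples of \<open>gcd n j\<close>, by Bezout's identity. So invariance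
  under the rotation by \<open>j\<close> is invariance under the one by \<open>gcd n j\<close>, that is, membership depends
  only on the residue modulo \<open>gcd n j\<close>.
\<close>

lemma rotation_fixed_iff:
  fixes n j :: nat
  assumes "n > 0" and S: "S \<subseteq> {0..<n}"
  defines "t \<equiv> gcd n j"
  shows "(\<lambda>x. (x + j) mod n) ` S = S \<longleftrightarrow> (\<exists>T. T \<subseteq> {0..<t} \<and> S = periodic_lift n t T)"
proof
  have "t > 0" "t dvd n" "t dvd j" using \<open>n > 0\<close> by (auto simp: t_def)
  {
    assume inv: "(\<lambda>x. (x + j) mod n) ` S = S"
    have iter: "(x + a * j) mod n \<in> S" if "x \<in> S" for x a
    proof (induction a)
      case 0
      show ?case using that S by auto
    next
      case (Suc a)
      then have "((x + a * j) mod n + j) mod n \<in> S" using inv by blast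
      then show ?case by (simp add: mod_simps algebra_simps)
    qed
    obtain c where c: "(x + t) mod n = (x + c * j) mod n" for x
    proof (cases "j = 0")
      case True
      then show ?thesis using that[of 0] by (simp add: t_def)
    next
      case False
      then obtain u v where uv: "j * u = n * v + t"
        using bezout_nat[of j n] by (auto simp: t_def gcd.commute)
      have "(x + u * j) mod n = (x + t) mod n" for x
      proof -
        have "x + u * j = (x + t) + n * v" using uv by (simp add: mult.commute)
        then show ?thesis by (metis mod_mult_self2)
      qed
      then show ?thesis using that[of u] by metis
    qed
    have iter_t: "(x + a * t) mod n \<in> S" if "x \<in> S" for x a
    proof (induction a)
      case 0
      show ?case using that S by auto
    next
      case (Suc a)
      have "(x + Suc a * t) mod n = ((x + a * t) mod n + t) mod n"
        by (simp add: mod_simps algebra_simps)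
      also have "\<dots> = ((x + a * t) mod n + c * j) mod n" by (rule c)
      also have "\<dots> \<in> S" using Suc.IH by (rule iter)
      finally show ?case .
    qed
    have periodic: "y \<in> S" if "x \<in> S" "y < n" "y mod t = x mod t" for x y
    proof -
      obtain d where n: "n = d * t" using \<open>t dvd n\<close> by (metis dvdE mult.commute)
      have "x < d * t" using \<open>x \<in> S\<close> S n by auto
      then have "x div t \<le> d" using less_mult_imp_div_less by (simp add: less_imp_le)
      then have "(y div t + d - x div t) * t + x div t * t = y div t * t + d * t"
        by (simp add: distrib_right[symmetric])
      moreover have "x = x div t * t + x mod t" "y = y div t * t + y mod t" by simp_all
      ultimately have "x + (y div t + d - x div t) * t = y + n"
        using that(3) n by linarith
      then show ?thesis using iter_t[OF \<open>x \<in> S\<close>, of "y div t + d - x div t"] \<open>y < n\<close> by simp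
    qed
    let ?T = "(\<lambda>x. x mod t) ` S"
    have "S = periodic_lift n t ?T"
      using periodic S by (auto simp: periodic_lift_def)
    moreover have "?T \<subseteq> {0..<t}" using \<open>t > 0\<close> by auto
    ultimately show "\<exists>T. T \<subseteq> {0..<t} \<and> S = periodic_lift n t T" by blast
  }
  {
    assume "\<exists>T. T \<subseteq> {0..<t} \<and> S = periodic_lift n t T"
    then obtain T where S': "S = periodic_lift n t T" by blast
    have shift: "(x + i) mod n \<in> S" if "x \<in> S" "t dvd i" for x i
    proof -
      have "(x + i) mod n mod t = x mod t"
        using \<open>t dvd n\<close> \<open>t dvd i\<close> by (auto simp: mod_mod_cancel elim!: dvdE)
      then show ?thesis using \<open>x \<in> S\<close> \<open>n > 0\<close> by (simp add: S' periodic_lift_def)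
    qed
    show "(\<lambda>x. (x + j) mod n) ` S = S"
    proof (intro equalityI subsetI)
      fix x assume x: "x \<in> S"
      then have "x < n" using S by auto
      \<comment> \<open>Modulo \<open>n\<close>, the number \<open>(n - 1) * j\<close> is \<open>- j\<close>.\<close>
      have "(x + (n - 1) * j) mod n \<in> S" using x \<open>t dvd j\<close> by (intro shift) auto
      moreover have "((x + (n - 1) * j) mod n + j) mod n = x"
      proof -
        have "(n - 1) * j + j = n * j" using \<open>n > 0\<close> by (cases n) auto
        then have "((x + (n - 1) * j) mod n + j) mod n = (x + n * j) mod n"
          by (metis add.assoc mod_add_left_eq)
        then show ?thesis using \<open>x < n\<close> by simp
      qed
      ultimately show "x \<in> (\<lambda>x. (x + j) mod n) ` S" by (metis imageI)
    qed (use shift \<open>t dvd j\<close> in auto)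
  }
qed

text \<open>
  Here \<open>d\<close> is the order of the rotation by \<open>j\<close>. The fixed sets are the lifts of the spaced sets on
  the cycle of length \<open>n div d\<close>, and lifting multiplies the cardinality by \<open>d\<close>.
\<close>

lemma card_rotation_fixed:
  fixes n j :: nat
  assumes "k > 0" and "(r + 1) * k \<le> n"
  defines "d \<equiv> n div gcd n j"
  shows "card {S \<in> cyclically_spaced_sets r n k. (\<lambda>x. (x + j) mod n) ` S = S} =
    (if d dvd k
     then ((n div d - r * (k div d)) choose (k div d))
            + r * ((n div d - r * (k div d) - 1) choose (k div d - 1))
     else 0)"
proof -
  have "n > 0" using assms by (auto intro: gr0I)
  define t where "t = gcd n j"
  have "t > 0" "t dvd n" using \<open>n > 0\<close> by (auto simp: t_def)
  then have n: "n = d * t" by (simp add: d_def t_def)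
  then have "d > 0" using \<open>n > 0\<close> by simp
  have nd: "n div d = t" using \<open>d > 0\<close> by (simp add: n)
  let ?Q = "{T. T \<subseteq> {0..<t} \<and> d * card T = k \<and> cyclically_spaced r t T}"
  let ?F = "{S \<in> cyclically_spaced_sets r n k. (\<lambda>x. (x + j) mod n) ` S = S}"
  have "?F = periodic_lift n t ` ?Q"
  proof -
    have "periodic_lift n t T \<in> cyclically_spaced_sets r n k \<longleftrightarrow> T \<in> ?Q" if "T \<subseteq> {0..<t}" for T
      using that cyclically_spaced_periodic_lift[OF \<open>n > 0\<close> \<open>t dvd n\<close> that]
        card_periodic_lift[OF \<open>t > 0\<close> that, of d]
      unfolding cyclically_spaced_sets_def n by (auto simp: periodic_lift_def)
    moreover have "S \<in> ?F \<longleftrightarrow> S \<in> cyclically_spaced_sets r n k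
        \<and> (\<exists>T. T \<subseteq> {0..<t} \<and> S = periodic_lift n t T)" for S
      using rotation_fixed_iff[OF \<open>n > 0\<close>, of S j]
      by (auto simp: cyclically_spaced_sets_def t_def)
    ultimately have "S \<in> ?F \<longleftrightarrow> (\<exists>T\<in>?Q. S = periodic_lift n t T)" for S
      by (metis (no_types, lifting) mem_Collect_eq)
    then show ?thesis by auto
  qed
  moreover have "inj_on (periodic_lift n t) ?Q"
  proof (rule inj_on_inverseI)
    fix T assume "T \<in> ?Q"
    moreover have "t \<le> n" using \<open>t dvd n\<close> \<open>n > 0\<close> by (simp add: dvd_imp_le)
    ultimately show "periodic_lift n t T \<inter> {0..<t} = T"
      by (auto simp: periodic_lift_def)
  qed
  ultimately have cardF: "card ?F = card ?Q" by (simp add: card_image)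
  show ?thesis
  proof (cases "d dvd k")
    case True
    then obtain b where k: "k = d * b" by (auto elim: dvdE)
    have "b > 0" using \<open>k > 0\<close> k by (cases b) auto
    have "d * ((r + 1) * b) \<le> d * t" using assms(2) unfolding k n by (simp only: ac_simps)
    then have "(r + 1) * b \<le> t" using \<open>d > 0\<close> by simp
    have "?Q = cyclically_spaced_sets r t b"
      using \<open>d > 0\<close> by (auto simp: cyclically_spaced_sets_def k)
    then show ?thesis
      unfolding cardF using card_cyclically_spaced_sets[OF \<open>b > 0\<close> \<open>(r + 1) * b \<le> t\<close>] \<open>d > 0\<close> nd
      by (simp add: k)
  next
    case False
    then have "?Q = {}" by auto
    with False show ?thesis unfolding cardF by simp
  qed
qed

section \<open>Group actions\<close>

lemma group_action_image_action:
  assumes "group_action G E \<phi>" and sub: "X \<subseteq> Pow E"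
    and closed: "\<And>h S. h \<in> carrier G \<Longrightarrow> S \<in> X \<Longrightarrow> \<phi> h ` S \<in> X"
  shows "group_action G X (image_action \<phi> X)"
proof -
  interpret group_action G E \<phi> by fact
  interpret group G using group_hom group_hom.axioms(1) by blast
  have mult: "\<phi> (h \<otimes>\<^bsub>G\<^esub> h') ` S = \<phi> h ` \<phi> h' ` S"
    if "h \<in> carrier G" "h' \<in> carrier G" "S \<in> X" for h h' S
    using that sub composition_rule by (auto simp: image_image subset_iff intro!: image_cong)
  have one: "\<phi> \<one>\<^bsub>G\<^esub> ` S = S" if "S \<in> X" for S
  proof -
    have "\<phi> \<one>\<^bsub>G\<^esub> x = x" if "x \<in> S" for x
      using \<open>S \<in> X\<close> that sub by (subst id_eq_one[symmetric]) auto
    then show ?thesis by simp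
  qed
  have bij: "image_action \<phi> X h \<in> Bij X" if h: "h \<in> carrier G" for h
  proof -
    have "bij_betw (image_action \<phi> X h) X X"
    proof (rule bij_betw_byWitness[where f' = "\<lambda>S. \<phi> (inv\<^bsub>G\<^esub> h) ` S"])
      show "\<forall>S\<in>X. \<phi> (inv\<^bsub>G\<^esub> h) ` image_action \<phi> X h S = S"
        using h by (simp add: image_action_def one flip: mult)
      show "\<forall>S\<in>X. image_action \<phi> X h (\<phi> (inv\<^bsub>G\<^esub> h) ` S) = S"
        using h by (simp add: image_action_def closed one flip: mult)
    qed (use h closed in \<open>auto simp: image_action_def\<close>)
    then show ?thesis by (simp add: Bij_def image_action_def)
  qed
  have "image_action \<phi> X \<in> hom G (BijGroup X)"
  proof (rule homI)
    fix h h' assume h: "h \<in> carrier G" "h' \<in> carrier G"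
    have "image_action \<phi> X (h \<otimes>\<^bsub>G\<^esub> h') = compose X (image_action \<phi> X h) (image_action \<phi> X h')"
      using h by (intro ext) (auto simp: image_action_def compose_def mult closed)
    then show "image_action \<phi> X (h \<otimes>\<^bsub>G\<^esub> h')
        = image_action \<phi> X h \<otimes>\<^bsub>BijGroup X\<^esub> image_action \<phi> X h'"
      using h bij by (simp add: BijGroup_def)
  qed (use bij in \<open>simp add: BijGroup_def\<close>)
  then show ?thesis
    by (simp add: group_action_def group_hom_def group_hom_axioms_def group_BijGroup group_axioms)
qed

lemma rotation_action_pow:
  fixes G (structure)
  assumes "group_action G {0..<n} \<phi>" and "g \<in> carrier G"
    and rot: "\<And>i. i \<in> {0..<n} \<Longrightarrow> \<phi> g i = (i + 1) mod n" and i: "i \<in> {0..<n}"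
  shows "\<phi> (g [^] (j::nat)) i = (i + j) mod n"
proof (induction j)
  interpret group_action G "{0..<n}" \<phi> by fact
  interpret group G using group_hom group_hom.axioms(1) by blast
  {
    case 0
    have "\<phi> \<one> i = i" using i by (subst id_eq_one[symmetric]) auto
    then show ?case using i by simp
  next
    case (Suc j)
    have "\<phi> (g [^] Suc j) i = \<phi> (g \<otimes> g [^] j) i"
      using \<open>g \<in> carrier G\<close> nat_pow_Suc2 by simp
    also have "\<dots> = \<phi> g (\<phi> (g [^] j) i)"
      using \<open>g \<in> carrier G\<close> i by (intro composition_rule) auto
    also have "\<dots> = (i + Suc j) mod n"
      using i Suc.IH by (simp add: rot mod_simps)
    finally show ?case .
  }
qed

section \<open>Cyclic sieving\<close>

theorem theorem1:
  fixes n r k :: nat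
    and G :: "'g monoid" and g :: 'g and \<phi> :: "'g \<Rightarrow> nat \<Rightarrow> nat"
  assumes "n > 0"
    and "group G" and "Coset.order G = n"
    and "g \<in> carrier G" and "subgroup_generated G {g} = G"
    and "group_action G {0..<n} \<phi>"
    and "\<And>i. i \<in> {0..<n} \<Longrightarrow> \<phi> g i = (i + 1) mod n"
    and "k > 0" and "(r + 1) * k \<le> n"
  defines "X \<equiv> independent_sets k {0..<n} (cycle_power_edges n r)"
  shows "\<exists>f :: int poly. q_indep_count k r n = to_fract f \<and>
           cyclic_sieving X G (image_action \<phi> X) (map_poly of_int f)"
proof -
  interpret group G by fact
  interpret action: group_action G "{0..<n}" \<phi> by fact
  have "(r + 1) * 1 \<le> (r + 1) * k" using \<open>k > 0\<close> by (intro mult_le_mono2) simp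
  then have "r < n" using \<open>(r + 1) * k \<le> n\<close> by simp
  then have X: "X = cyclically_spaced_sets r n k"
    unfolding X_def by (rule independent_sets_cycle_power)
  then have X_sub: "X \<subseteq> Pow {0..<n}" by (auto simp: cyclically_spaced_sets_def)
  then have "finite X" by (rule finite_subset) simp
  have "finite (carrier G)"
    using \<open>Coset.order G = n\<close> \<open>n > 0\<close> by (intro card_ge_0_finite) (simp add: Coset.order_def)
  have carrier_gen: "carrier G = generate G {g}"
  proof -
    have "carrier G = carrier (subgroup_generated G {g})" using assms(5) by simp
    then show ?thesis using \<open>g \<in> carrier G\<close> by (simp add: carrier_subgroup_generated)
  qed
  have ord_g: "ord g = n"
    using generate_pow_card[OF \<open>g \<in> carrier G\<close>] \<open>Coset.order G = n\<close>
    by (simp add: Coset.order_def flip: carrier_gen)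
  have carrier_pow: "\<exists>j::nat. h = g [^]\<^bsub>G\<^esub> j" if "h \<in> carrier G" for h
    using that generate_pow_on_finite_carrier[OF \<open>finite (carrier G)\<close> \<open>g \<in> carrier G\<close>]
    unfolding carrier_gen by blast
  have image_pow: "\<phi> (g [^]\<^bsub>G\<^esub> j) ` S = (\<lambda>x. (x + j) mod n) ` S" if "S \<in> X" for S and j :: nat
  proof (rule image_cong[OF refl])
    fix x assume "x \<in> S"
    with that X_sub have "x \<in> {0..<n}" by blast
    then show "\<phi> (g [^]\<^bsub>G\<^esub> j) x = (x + j) mod n"
      using assms(7) by (intro rotation_action_pow[OF assms(6,4)])
  qed
  have "group_action G X (image_action \<phi> X)"
  proof (rule group_action_image_action[OF assms(6) X_sub])
    fix h S assume "h \<in> carrier G" "S \<in> X"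
    moreover from this obtain j :: nat where "h = g [^]\<^bsub>G\<^esub> j" using carrier_pow by blast
    ultimately show "\<phi> h ` S \<in> X"
      using image_pow cyclically_spaced_sets_rotate by (simp add: X)
  qed
  moreover have "of_nat (card {S \<in> X. image_action \<phi> X h S = S})
      = poly (map_poly of_int (indep_poly k r n)) w"
    if "h \<in> carrier G" and w: "primitive_root_of_unity (ord h) w" for h w
  proof -
    obtain j :: nat where h: "h = g [^]\<^bsub>G\<^esub> j" using carrier_pow \<open>h \<in> carrier G\<close> by blast
    have ord_h: "ord h = n div gcd n j"
      using ord_pow_gen[OF \<open>g \<in> carrier G\<close>, of j] \<open>n > 0\<close> by (simp add: h ord_g)
    have "ord h dvd n" unfolding ord_h by (metis dvd_div_mult_self dvd_triv_left gcd_dvd1)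
    have "{S \<in> X. image_action \<phi> X h S = S}
        = {S \<in> cyclically_spaced_sets r n k. (\<lambda>x. (x + j) mod n) ` S = S}"
      using image_pow by (auto simp: image_action_def h X)
    then have "of_nat (card {S \<in> X. image_action \<phi> X h S = S}) = eval_at w (indep_poly k r n)"
      using card_rotation_fixed[OF assms(8,9), of j, folded ord_h]
        eval_at_indep_poly_dvd[OF w _ \<open>ord h dvd n\<close> assms(8,9)]
        eval_at_indep_poly_not_dvd[OF w _ \<open>ord h dvd n\<close> assms(8,9)]
      by (cases "ord h dvd k") (simp_all only: if_True if_False of_nat_0 not_False_eq_True)
    then show ?thesis by (simp add: eval_at_def)
  qed
  moreover have "cyclic_group G"
    using assms(4,5) by (auto simp: cyclic_group_def)
  ultimately have "cyclic_sieving X G (image_action \<phi> X) (map_poly of_int (indep_poly k r n))"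
    using \<open>finite X\<close> \<open>finite (carrier G)\<close> \<open>group G\<close> by (simp add: cyclic_sieving_def)
  with q_indep_count_eq_indep_poly[OF assms(8,9)] show ?thesis by blast
qed

end
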